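(* Let $n\ge 1$ and $f:\mathbb{R}^n\to\mathbb{R}\cup\{+\infty\}$, with $X=\{x\in\mathbb{R}^n: f(x)\ne+\infty\}$, satisfy: (a) $f$ is bounded below and all its sublevel sets are bounded; (b) the restriction $f_{|X}:X\to\mathbb{R}$ is lower semicontinuous; (c) there are $N\in\mathbb{N}^*\cup\{+\infty\}$ and a partition $X=\bigsqcup_{i=1}^N X_i$ such that, for every $i$, $X_i$ is ample and $f_{|X_i}:X_i\to\mathbb{R}$ is continuous. Consider any run of the generic algorithm with a covering step (defined in the context) on $f$, with covering radius $r>0$ and a covering oracle $\mathbb{O}$ of radius $r$, generating $(x^k,\mathcal{H}^k)_{k\in\mathbb{N}}$, and let $\mathcal{A}$ be the set of limits of all converging subsequences of $(x^k)_{k\in\mathbb{N}}$. Then $\mathcal{A}\neq\emptyset$, and for every $x^*\in\mathcal{A}$ and every infinite $K^*\subseteq\mathbb{N}$ such that $(x^k)_{k\in K^*}$ converges to $x^*$, $$\lim_{k\in K^*} f(x^k)=\begin{cases}\min f(\mathcal{B}_r(x^* ))=f(x^* ) & \text{if } x^*\in X,\\ \inf f(\mathcal{B}_r(x^* )) & \text{if } x^*\notin X.\end{cases}$$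
   Context: Notation: $\mathcal{B}_r(x)$ is the open ball of radius $r$ centered at $x$ (for a fixed norm $\|\cdot\|$ on $\mathbb{R}^n$), $\mathcal{B}_r=\mathcal{B}_r(0)$, $\mathrm{cl}$ and $\mathrm{int}$ are closure and interior, $f(S)=\{f(s):s\in S\}$, $\{x\}+S=\{x+s:s\in S\}$, $\mathrm{dist}(x,S)=\inf\{\|x-s\|:s\in S\}$, and "$t\in\operatorname{argmin} f(S)$" means that $t$ minimizes $f$ over $S$. A set $S\subseteq\mathbb{R}^n$ is ample if $S\subseteq\mathrm{cl}(\mathrm{int}(S))$. Covering oracle: for $r>0$, a function $\mathbb{O}:\mathbb{R}^n\times 2^{\mathbb{R}^n}\to 2^{\mathbb{R}^n}$ is a covering oracle of radius $r$ if there is $\beta\in{]0,1]}$ such that, for all $x\in\mathbb{R}^n$ and all nonempty $S\subseteq\mathbb{R}^n$, the set $\mathbb{O}(x,S)$ is compact, $\emptyset\ne\mathbb{O}(x,S)\subseteq\mathrm{cl}(\mathcal{B}_r)$, and $$\max_{d\in\mathbb{O}(x,S)}\mathrm{dist}(x+d,S)\ \ge\ \beta\max_{d\in\mathrm{cl}(\mathcal{B}_r)}\mathrm{dist}(x+d,S).$$ Generic algorithm with a covering step. Initialization: choose $r>0$ and a covering oracle $\mathbb{O}$ of radius $r$; $x^0\in X$; $\mathcal{H}^0=\emptyset$. For each $k=0,1,2,\dots$: - Covering step: $\mathcal{D}_C^k=\mathbb{O}(x^k,\mathcal{H}^k)$; $\mathcal{T}_C^k=\{x^k\}+\mathcal{D}_C^k$;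 choose $t_C^k\in\operatorname{argmin} f(\mathcal{T}_C^k)$. If $f(t_C^k)<f(x^k)$, set $t^k=t_C^k$, $\mathcal{T}_O^k=\emptyset$, and go to the update step. - Optional step: choose $\mathcal{D}_O^k\subseteq\mathbb{R}^n$ empty or finite; $\mathcal{T}_O^k=\{x^k\}+\mathcal{D}_O^k$. If $\mathcal{T}_O^k\ne\emptyset$, choose $t_O^k\in\operatorname{argmin} f(\mathcal{T}_O^k)$. If $\mathcal{T}_O^k\neq\emptyset$ and $f(t_O^k)<f(x^k)$, set $t^k=t_O^k$; otherwise set $t^k=x^k$. - Update step: $x^{k+1}=t^k$; $\mathcal{H}^{k+1}=\mathcal{H}^k\cup\mathcal{T}_C^k\cup\mathcal{T}_O^k$. A run is an infinite execution in which all the prescribed choices exist (in particular every $\operatorname{argmin} f(\mathcal{T}_C^k)$, including for $k=0$, is nonempty). *)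

theory Defs
  imports "HOL-Analysis.Analysis" "HOL-Library.Extended_Nat" "HOL-Library.Infinite_Set"
begin

(* The norm of the underlying space is arbitrary. Since all norms on a finite-dimensional space
   are equivalent, the library's topological notions (closure, interior, compact, bounded,
   convergence) are those of this norm as well; only balls and distances depend on it. *)

definition is_norm :: "('a::real_vector \<Rightarrow> real) \<Rightarrow> bool" where
  "is_norm nrm \<longleftrightarrow>
     (\<forall>x. 0 \<le> nrm x) \<and> (\<forall>x. nrm x = 0 \<longleftrightarrow> x = 0) \<and>
     (\<forall>a x. nrm (a *\<^sub>R x) = \<bar>a\<bar> * nrm x) \<and>
     (\<forall>x y. nrm (x + y) \<le> nrm x + nrm y)"

definition nball :: "('a::real_vector \<Rightarrow> real) \<Rightarrow> real \<Rightarrow> 'a \<Rightarrow> 'a set" where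
  "nball nrm r x = {y. nrm (y - x) < r}"

definition ndist :: "('a::real_vector \<Rightarrow> real) \<Rightarrow> 'a \<Rightarrow> 'a set \<Rightarrow> real" where
  "ndist nrm x S = (INF s\<in>S. nrm (x - s))"

definition ample :: "'a::topological_space set \<Rightarrow> bool" where
  "ample S \<longleftrightarrow> S \<subseteq> closure (interior S)"

(* If x is isolated in S then the filter is trivial and the Liminf is infinite, so that
   the condition at x holds, as it should. *)
definition lower_semicontinuous_on :: "'a::topological_space set \<Rightarrow> ('a \<Rightarrow> ereal) \<Rightarrow> bool" where
  "lower_semicontinuous_on S f \<longleftrightarrow> (\<forall>x\<in>S. f x \<le> Liminf (at x within S) f)"

definition argmin_on :: "('a \<Rightarrow> ereal) \<Rightarrow> 'a set \<Rightarrow> 'a set" where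
  "argmin_on f S = {t. is_arg_min f (\<lambda>s. s \<in> S) t}"

(* The suprema below are maxima: for nonempty S the distance to S is continuous and bounded on
   the nonempty compact sets concerned. Nothing is required of the oracle when S is empty. *)
definition covering_oracle ::
    "('a::real_normed_vector \<Rightarrow> real) \<Rightarrow> real \<Rightarrow> ('a \<Rightarrow> 'a set \<Rightarrow> 'a set) \<Rightarrow> bool" where
  "covering_oracle nrm r orc \<longleftrightarrow>
     (\<exists>\<beta>. 0 < \<beta> \<and> \<beta> \<le> 1 \<and>
        (\<forall>x S. S \<noteq> {} \<longrightarrow>
           compact (orc x S) \<and> orc x S \<noteq> {} \<and> orc x S \<subseteq> closure (nball nrm r 0) \<and>
           (SUP d\<in>orc x S. ndist nrm (x + d) S)
             \<ge> \<beta> * (SUP d\<in>closure (nball nrm r 0). ndist nrm (x + d) S)))"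

(* One iteration, from (x, H) to (x', H'): TC and tC are the covering trial set and its chosen
   minimizer; DO is the finite (possibly empty) set of optional directions, TO the optional
   trial set and tO its chosen minimizer, which plays no role when TO is empty. *)
definition iteration ::
    "('a::real_normed_vector \<Rightarrow> ereal) \<Rightarrow> ('a \<Rightarrow> 'a set \<Rightarrow> 'a set) \<Rightarrow>
     'a \<Rightarrow> 'a set \<Rightarrow> 'a \<Rightarrow> 'a set \<Rightarrow> bool" where
  "iteration f orc x H x' H' \<longleftrightarrow>
     (\<exists>TC tC. TC = (\<lambda>d. x + d) ` orc x H \<and> tC \<in> argmin_on f TC \<and>
        (if f tC < f x
         then x' = tC \<and> H' = H \<union> TC
         else (\<exists>DO TO tO. finite DO \<and> TO = (\<lambda>d. x + d) ` DO \<and>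
                 (TO \<noteq> {} \<longrightarrow> tO \<in> argmin_on f TO) \<and>
                 x' = (if TO \<noteq> {} \<and> f tO < f x then tO else x) \<and>
                 H' = H \<union> TC \<union> TO)))"

definition algorithm_run ::
    "('a::real_normed_vector \<Rightarrow> ereal) \<Rightarrow> ('a \<Rightarrow> 'a set \<Rightarrow> 'a set) \<Rightarrow>
     (nat \<Rightarrow> 'a) \<Rightarrow> (nat \<Rightarrow> 'a set) \<Rightarrow> bool" where
  "algorithm_run f orc x H \<longleftrightarrow>
     f (x 0) \<noteq> \<infinity> \<and> H 0 = {} \<and>
     (\<forall>k. iteration f orc (x k) (H k) (x (Suc k)) (H (Suc k)))"

(* The subsequence of x indexed by an infinite set K of naturals is "x o enumerate K". *)
definition subseq_limits :: "(nat \<Rightarrow> 'a::topological_space) \<Rightarrow> 'a set" where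
  "subseq_limits x = {a. \<exists>K. infinite K \<and> (x \<circ> enumerate K) \<longlonglongrightarrow> a}"

end

theory Submission
  imports Defs
begin

text \<open>
  Along a run the values \<open>f (x k)\<close> decrease to a limit \<open>L\<close>, and every point of the history
  \<open>H k\<close> has a value at least \<open>f (x k)\<close>, hence at least \<open>L\<close>: each trial point has been compared,
  through the chosen minimizer of its trial set, with the incumbent. The iterates stay in a
  sublevel set, which is bounded, so they accumulate somewhere.

  The covering step makes the history dense near every accumulation point \<open>a\<close>. If the ball of
  radius \<open>r\<close> around \<open>x k\<close> contained, for infinitely many \<open>k\<close>, a point at distance at least \<open>e\<close>
  from \<open>H k\<close>, then the oracle would infinitely often add a trial point at distance more than
  \<open>\<beta> * e / 2\<close> from all earlier ones. These points would form a bounded separated sequence, which is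
  impossible in finite dimension (\<open>covering_radius_tendsto_zero\<close>). Therefore the open ball of
  radius \<open>r\<close> around \<open>a\<close> lies in the closure of the union of all histories
  (\<open>nball_subset_closure_history\<close>).

  It remains to transfer the bound \<open>L \<le> f\<close> from that dense set to the whole ball. At a point
  \<open>y\<close> of a piece \<open>P i\<close> the set of points of \<open>P i\<close> with value below \<open>L\<close> is relatively open; if
  it contained \<open>y\<close> then, as \<open>P i\<close> is ample, it would contain a nonempty open set, and that open set
  would contain a point of the history (\<open>ample_continuous_lower_bound\<close>). Thus \<open>L\<close> is a
  lower bound of \<open>f\<close> on the ball. If \<open>a \<in> X\<close>, lower semicontinuity gives \<open>f a \<le> L\<close>, so
  \<open>f a = L\<close> is the minimum. If \<open>a \<notin> X\<close>, the iterates near \<open>a\<close> lie in the ball and their values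
  tend to \<open>L\<close>, so \<open>L\<close> is the infimum.
\<close>

section \<open>Norms and norm distances\<close>

lemma is_norm_minus_commute:
  assumes "is_norm nrm"
  shows "nrm (y - z) = nrm (z - y)"
proof -
  have "nrm ((-1) *\<^sub>R (z - y)) = \<bar>-1\<bar> * nrm (z - y)"
    using assms unfolding is_norm_def by blast
  then show ?thesis by simp
qed

text \<open>
  The two comparisons with the Euclidean norm let the compactness arguments use Euclidean
  bounded sets while the balls and distances stay those of \<open>nrm\<close>. The upper bound comes from expanding
  a vector in the standard basis; it makes \<open>nrm\<close> continuous, so the lower bound follows from the
  minimum of \<open>nrm\<close> on the compact unit sphere.
\<close>

lemma is_norm_upper:
  fixes nrm :: "'a::euclidean_space \<Rightarrow> real"
  assumes "is_norm nrm"
  shows "\<exists>C>0. \<forall>z. nrm z \<le> C * norm z"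
proof -
  have nonneg: "0 \<le> nrm x" and zero: "nrm x = 0 \<longleftrightarrow> x = 0"
    and scale: "nrm (b *\<^sub>R x) = \<bar>b\<bar> * nrm x"
    and tri: "nrm (x + y) \<le> nrm x + nrm y" for x y b
    using assms unfolding is_norm_def by blast+
  have sum_le: "nrm (sum g A) \<le> (\<Sum>i\<in>A. nrm (g i))" if "finite A" for g :: "'a \<Rightarrow> 'a" and A
    using that
  proof (induction A rule: finite_induct)
    case empty
    then show ?case using zero[of 0] by simp
  next
    case (insert i A)
    then show ?case using tri[of "g i" "sum g A"] by simp
  qed
  define C where "C = (\<Sum>b\<in>Basis. nrm (b::'a)) + 1"
  have Cpos: "0 < C"
    unfolding C_def using sum_nonneg[of Basis nrm] nonneg by fastforce
  have upper: "nrm x \<le> C * norm x" for x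
  proof -
    have "nrm x = nrm (\<Sum>b\<in>Basis. (x \<bullet> b) *\<^sub>R b)"
      by (simp add: euclidean_representation)
    also have "\<dots> \<le> (\<Sum>b\<in>Basis. \<bar>x \<bullet> b\<bar> * nrm b)"
      using sum_le[of Basis "\<lambda>b. (x \<bullet> b) *\<^sub>R b"] by (simp add: scale)
    also have "\<dots> \<le> (\<Sum>b\<in>Basis. norm x * nrm b)"
      by (intro sum_mono mult_right_mono) (auto simp: Basis_le_norm nonneg)
    also have "\<dots> = (C - 1) * norm x"
      by (simp add: C_def sum_distrib_left mult.commute)
    also have "\<dots> \<le> C * norm x"
      by (simp add: algebra_simps)
    finally show ?thesis .
  qed
  show ?thesis using Cpos upper by blast
qed

lemma is_norm_lower:
  fixes nrm :: "'a::euclidean_space \<Rightarrow> real"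
  assumes "is_norm nrm"
  shows "\<exists>c>0. \<forall>z. c * norm z \<le> nrm z"
proof -
  have nonneg: "0 \<le> nrm x" and zero: "nrm x = 0 \<longleftrightarrow> x = 0"
    and scale: "nrm (b *\<^sub>R x) = \<bar>b\<bar> * nrm x"
    and tri: "nrm (x + y) \<le> nrm x + nrm y" for x y b
    using assms unfolding is_norm_def by blast+
  obtain C where Cpos: "0 < C" and upper: "\<And>x. nrm x \<le> C * norm x"
    using is_norm_upper[OF assms] by blast
  have diff: "\<bar>nrm x - nrm y\<bar> \<le> nrm (x - y)" for x y
    using tri[of "x - y" y] tri[of "y - x" x] is_norm_minus_commute[OF assms, of x y] by simp
  have "C-lipschitz_on UNIV nrm"
    using Cpos diff upper unfolding lipschitz_on_def dist_norm real_norm_def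
    by (meson less_imp_le order_trans)
  then have cont: "continuous_on (sphere 0 1) nrm"
    using lipschitz_on_continuous_on continuous_on_subset by blast
  have "sphere (0::'a) 1 \<noteq> {}"
    by simp
  then obtain u where u: "u \<in> sphere 0 1" "\<And>v. v \<in> sphere 0 1 \<Longrightarrow> nrm u \<le> nrm v"
    using continuous_attains_inf[OF compact_sphere _ cont] by blast
  have "u \<noteq> 0" using u(1) by auto
  then have upos: "0 < nrm u"
    using nonneg[of u] zero[of u] by linarith
  have lower: "nrm u * norm x \<le> nrm x" for x
  proof (cases "x = 0")
    case False
    then have "nrm u \<le> nrm ((1 / norm x) *\<^sub>R x)"
      by (intro u(2)) simp
    then show ?thesis
      using False by (simp add: scale field_simps)
  qed (simp add: nonneg)
  show ?thesis using upos lower by blast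
qed

lemma bounded_nball:
  fixes nrm :: "'a::euclidean_space \<Rightarrow> real"
  assumes "is_norm nrm"
  shows "bounded (nball nrm r 0)"
proof -
  obtain c where c: "0 < c" "\<And>z. c * norm z \<le> nrm z"
    using is_norm_lower[OF assms] by blast
  show ?thesis
    unfolding bounded_iff
  proof (intro exI ballI)
    fix y assume "y \<in> nball nrm r 0"
    then have "c * norm y \<le> r" using c(2)[of y] by (simp add: nball_def)
    then show "norm y \<le> r / c" using c(1) by (simp add: field_simps)
  qed
qed

lemma open_nball:
  fixes nrm :: "'a::euclidean_space \<Rightarrow> real"
  assumes "is_norm nrm"
  shows "open (nball nrm r a)"
  unfolding open_dist
proof
  obtain C where C: "0 < C" "\<And>z. nrm z \<le> C * norm z"
    using is_norm_upper[OF assms] by blast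
  fix y assume y: "y \<in> nball nrm r a"
  show "\<exists>e>0. \<forall>z. dist z y < e \<longrightarrow> z \<in> nball nrm r a"
  proof (intro exI conjI allI impI)
    show "0 < (r - nrm (y - a)) / C" using y C(1) by (simp add: nball_def)
    fix z assume "dist z y < (r - nrm (y - a)) / C"
    then have "nrm (z - y) < r - nrm (y - a)"
      using C(1) C(2)[of "z - y"] by (simp add: field_simps dist_norm)
    moreover have "nrm ((z - y) + (y - a)) \<le> nrm (z - y) + nrm (y - a)"
      using assms unfolding is_norm_def by blast
    ultimately show "z \<in> nball nrm r a" by (simp add: nball_def)
  qed
qed

lemma ndist_le:
  assumes "is_norm nrm" "s \<in> S"
  shows "ndist nrm y S \<le> nrm (y - s)"
  unfolding ndist_def using assms
  by (intro cINF_lower bdd_belowI2[where m = 0]) (auto simp: is_norm_def)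

lemma ndist_less_witness:
  assumes "ndist nrm y S < e" "S \<noteq> {}"
  obtains s where "s \<in> S" "nrm (y - s) < e"
  using cINF_greatest[of S e "\<lambda>s. nrm (y - s)"] assms
  unfolding ndist_def by (meson not_le)

section \<open>Subsequences\<close>

lemma enumerate_range_strict_mono:
  fixes q :: "nat \<Rightarrow> nat"
  assumes q: "strict_mono q"
  shows "enumerate (range q) = q"
proof
  have inf: "infinite (range q)"
    using q by (simp add: range_inj_infinite strict_mono_imp_inj_on)
  fix n show "enumerate (range q) n = q n"
  proof (induction n)
    case 0
    show ?case
      unfolding enumerate_0 using q
      by (intro Least_equality) (auto simp: strict_mono_less_eq)
  next
    case (Suc n)
    show ?case
      unfolding enumerate_Suc''[OF inf] Suc using q
      by (intro Least_equality) (auto simp: strict_mono_less strict_mono_less_eq)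
  qed
qed

lemma bounded_sequence_close_pair:
  fixes t :: "nat \<Rightarrow> 'a::heine_borel"
  assumes "infinite M" "bounded (t ` M)" "0 < e"
  obtains j k where "j \<in> M" "k \<in> M" "j < k" "dist (t j) (t k) < e"
proof -
  have "bounded (range (t \<circ> enumerate M))"
    by (rule bounded_subset[OF assms(2)]) (auto simp: enumerate_in_set assms(1))
  then obtain l q where q: "strict_mono (q :: nat \<Rightarrow> nat)"
    and "(t \<circ> enumerate M \<circ> q) \<longlonglongrightarrow> l"
    using bounded_imp_convergent_subsequence by blast
  then have "Cauchy (t \<circ> enumerate M \<circ> q)"
    using LIMSEQ_imp_Cauchy by blast
  then obtain n where
    "\<forall>i\<ge>n. \<forall>j\<ge>n. dist ((t \<circ> enumerate M \<circ> q) i) ((t \<circ> enumerate M \<circ> q) j) < e"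
    using assms(3) unfolding Cauchy_def by blast
  then have "dist (t (enumerate M (q n))) (t (enumerate M (q (Suc n)))) < e"
    by simp
  moreover have "enumerate M (q n) < enumerate M (q (Suc n))"
    using strict_mono_enumerate[OF assms(1)] q by (simp add: strict_mono_def)
  ultimately show ?thesis
    using that enumerate_in_set[OF assms(1)] by blast
qed

section \<open>Continuity on ample sets and semicontinuity\<close>

text \<open>
  Ampleness is what makes density of \<open>D\<close> usable: \<open>D\<close> need not approach \<open>y\<close> from within \<open>S\<close>, but
  it does meet every nonempty open subset of \<open>U \<inter> S\<close>.
\<close>

lemma ample_continuous_lower_bound:
  fixes f :: "'a::topological_space \<Rightarrow> 'b::linorder_topology"
  assumes "ample S" "continuous_on S f" "open U" "U \<subseteq> closure D"
    and D: "\<And>h. h \<in> D \<Longrightarrow> L \<le> f h" and y: "y \<in> U" "y \<in> S"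
  shows "L \<le> f y"
proof (rule ccontr)
  assume "\<not> L \<le> f y"
  obtain A where A: "open A" "A \<inter> S = f -` {..<L} \<inter> S"
    using assms(2) unfolding continuous_on_open_invariant by (meson open_lessThan)
  then have "y \<in> A \<inter> U"
    using \<open>\<not> L \<le> f y\<close> y by auto
  moreover have "y \<in> closure (interior S)"
    using assms(1) y unfolding ample_def by blast
  ultimately have "A \<inter> U \<inter> interior S \<noteq> {}"
    using open_Int_closure_eq_empty[of "A \<inter> U" "interior S"] A(1) assms(3) by auto
  then have "(A \<inter> U \<inter> interior S) \<inter> closure D \<noteq> {}"
    using assms(4) by blast
  then have "(A \<inter> U \<inter> interior S) \<inter> D \<noteq> {}"
    using open_Int_closure_eq_empty[of "A \<inter> U \<inter> interior S" D] A(1) assms(3) by auto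
  then obtain h where "h \<in> A" "h \<in> interior S" "h \<in> D" by blast
  then have "f h < L"
    using A(2) interior_subset[of S] by blast
  then show False
    using D[OF \<open>h \<in> D\<close>] by simp
qed

lemma lower_semicontinuous_on_sequence:
  fixes z :: "nat \<Rightarrow> 'a::topological_space"
  assumes "lower_semicontinuous_on X f" "a \<in> X" "\<And>k. z k \<in> X" "z \<longlonglongrightarrow> a"
    and lim: "(\<lambda>k. f (z k)) \<longlonglongrightarrow> L"
  shows "f a \<le> L"
proof (rule dense_le)
  fix c assume c: "c < f a"
  have "f a \<le> Liminf (at a within X) f"
    using assms(1,2) unfolding lower_semicontinuous_on_def by blast
  then have "eventually (\<lambda>w. c < f w) (at a within X)"
    using c unfolding le_Liminf_iff by blast
  \<comment> \<open>The punctured filter says nothing at \<open>a\<close> itself, where the bound is \<open>c < f a\<close>.\<close>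
  then have "eventually (\<lambda>w. w \<in> X \<longrightarrow> c < f w) (nhds a)"
    unfolding eventually_at_filter by eventually_elim (use c in auto)
  then have "eventually (\<lambda>k. c < f (z k)) sequentially"
    using assms(3,4) by (auto simp: filterlim_iff)
  then show "c \<le> L"
    by (intro tendsto_lowerbound[OF lim]) (auto elim: eventually_mono)
qed

section \<open>Monotonicity along a run\<close>

text \<open>
  New history points are never better than the next iterate: if the minimizer of a trial set
  improves on the current iterate, it becomes the next iterate; otherwise no point of that
  trial set improves on it.
\<close>

lemma iteration_facts:
  assumes "iteration f orc x H x' H'"
  shows iteration_descent: "f x' \<le> f x"
    and iteration_history_subset: "H \<subseteq> H'"
    and iteration_trial_subset: "(\<lambda>d. x + d) ` orc x H \<subseteq> H'"
    and iteration_history_nonempty: "H' \<noteq> {}"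
    and iteration_history_value: "\<And>h. h \<in> H' \<Longrightarrow> h \<notin> H \<Longrightarrow> f x' \<le> f h"
proof -
  obtain tC where tC: "tC \<in> argmin_on f ((\<lambda>d. x + d) ` orc x H)"
    and step: "if f tC < f x then x' = tC \<and> H' = H \<union> (\<lambda>d. x + d) ` orc x H
         else (\<exists>DO TO tO. finite DO \<and> TO = (\<lambda>d. x + d) ` DO \<and>
                 (TO \<noteq> {} \<longrightarrow> tO \<in> argmin_on f TO) \<and>
                 x' = (if TO \<noteq> {} \<and> f tO < f x then tO else x) \<and>
                 H' = H \<union> (\<lambda>d. x + d) ` orc x H \<union> TO)"
    using assms unfolding iteration_def by blast
  have argmin: "t \<in> S \<and> (\<forall>s\<in>S. f t \<le> f s)" if "t \<in> argmin_on f S" for t S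
    using that unfolding argmin_on_def is_arg_min_def by (auto simp: not_less)
  note TC = argmin[OF tC]
  have all: "f x' \<le> f x \<and> H \<subseteq> H' \<and> (\<lambda>d. x + d) ` orc x H \<subseteq> H' \<and> H' \<noteq> {} \<and>
      (\<forall>h\<in>H'. h \<notin> H \<longrightarrow> f x' \<le> f h)"
  proof (cases "f tC < f x")
    case True
    then have "x' = tC" "H' = H \<union> (\<lambda>d. x + d) ` orc x H"
      using step by auto
    then show ?thesis
      using TC True by fastforce
  next
    case False
    then obtain TO tO where TO: "TO \<noteq> {} \<longrightarrow> tO \<in> argmin_on f TO"
      and x': "x' = (if TO \<noteq> {} \<and> f tO < f x then tO else x)"
      and H': "H' = H \<union> (\<lambda>d. x + d) ` orc x H \<union> TO"
      using step unfolding if_not_P[OF False] by blast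
    have desc: "f x' \<le> f x"
      using x' by auto
    have "f x' \<le> f h" if "h \<in> (\<lambda>d. x + d) ` orc x H" for h
      using TC that False desc by (meson not_less order_trans)
    moreover have "f x' \<le> f h" if "h \<in> TO" for h
    proof -
      have "f tO \<le> f h" using TO argmin that by blast
      then show ?thesis
        using that x' by (auto simp: not_less)
    qed
    ultimately show ?thesis
      using desc H' TC by blast
  qed
  show "f x' \<le> f x" "H \<subseteq> H'" "(\<lambda>d. x + d) ` orc x H \<subseteq> H'" "H' \<noteq> {}"
    "\<And>h. h \<in> H' \<Longrightarrow> h \<notin> H \<Longrightarrow> f x' \<le> f h"
    using all by blast+
qed

lemma
  assumes "algorithm_run f orc x H"
  shows run_values_decseq: "decseq (\<lambda>k. f (x k))"
    and run_history_incseq: "incseq H"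
    and run_history_value: "h \<in> H k \<Longrightarrow> f (x k) \<le> f h"
proof -
  have it: "iteration f orc (x k) (H k) (x (Suc k)) (H (Suc k))" for k
    using assms unfolding algorithm_run_def by blast
  show "decseq (\<lambda>k. f (x k))"
    using iteration_descent[OF it] by (rule decseq_SucI)
  show "incseq H"
    using iteration_history_subset[OF it] by (rule incseq_SucI)
  show "h \<in> H k \<Longrightarrow> f (x k) \<le> f h"
  proof (induction k)
    case 0
    then show ?case using assms unfolding algorithm_run_def by simp
  next
    case (Suc k)
    then show ?case
      using iteration_descent[OF it[of k]] iteration_history_value[OF it[of k]]
      by (meson order_trans)
  qed
qed

section \<open>Density of the history\<close>

text \<open>
  The oracle does at least a fixed fraction of the best possible, so a large gap in the history
  near \<open>x\<close> yields a trial direction whose trial point is far from the history. Halving the bound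
  makes it strictly smaller than the supremum over the trial directions, so that some direction
  exceeds it.
\<close>

lemma covering_oracle_gap:
  fixes nrm :: "'a::euclidean_space \<Rightarrow> real"
  assumes nrm: "is_norm nrm" and "covering_oracle nrm r orc"
  obtains \<beta> where "0 < \<beta>"
    "\<And>x S. S \<noteq> {} \<Longrightarrow> orc x S \<subseteq> closure (nball nrm r 0)"
    "\<And>x S y e. \<lbrakk>S \<noteq> {}; nrm (y - x) < r; e \<le> ndist nrm y S; 0 < e\<rbrakk> \<Longrightarrow>
       \<exists>d\<in>orc x S. \<beta> * e / 2 < ndist nrm (x + d) S"
proof -
  obtain \<beta> where \<beta>: "0 < \<beta>" and
    orc_all: "\<forall>x S. S \<noteq> {} \<longrightarrow> compact (orc x S) \<and> orc x S \<noteq> {} \<and>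
           orc x S \<subseteq> closure (nball nrm r 0) \<and>
           (SUP d\<in>orc x S. ndist nrm (x + d) S)
             \<ge> \<beta> * (SUP d\<in>closure (nball nrm r 0). ndist nrm (x + d) S)"
    using assms(2) unfolding covering_oracle_def by (elim exE conjE)
  have orc: "orc x S \<noteq> {}" "orc x S \<subseteq> closure (nball nrm r 0)"
    "\<beta> * (SUP d\<in>closure (nball nrm r 0). ndist nrm (x + d) S)
       \<le> (SUP d\<in>orc x S. ndist nrm (x + d) S)" if "S \<noteq> {}" for x S
    using orc_all that by simp_all
  obtain C where C: "0 < C" "\<And>z. nrm z \<le> C * norm z"
    using is_norm_upper[OF nrm] by blast
  have "bounded (closure (nball nrm r 0))"
    by (intro bounded_closure bounded_nball nrm)
  then obtain B where B: "\<And>d. d \<in> closure (nball nrm r 0) \<Longrightarrow> norm d \<le> B"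
    unfolding bounded_iff by blast
  have bdd: "bdd_above ((\<lambda>d. ndist nrm (x + d) S) ` A)"
    if S: "S \<noteq> {}" and A: "A \<subseteq> closure (nball nrm r 0)" for x S A
  proof -
    obtain s where s: "s \<in> S" using S by blast
    show ?thesis
    proof (rule bdd_aboveI2)
      fix d assume "d \<in> A"
      then have "norm d \<le> B" using A B by blast
      have "ndist nrm (x + d) S \<le> nrm (x + d - s)"
        by (rule ndist_le[OF nrm s])
      also have "\<dots> \<le> C * norm ((x - s) + d)"
        using C(2)[of "x + d - s"] by (simp add: algebra_simps)
      also have "\<dots> \<le> C * (norm (x - s) + B)"
        using norm_triangle_ineq[of "x - s" d] \<open>norm d \<le> B\<close> C(1)
        by (intro mult_left_mono) auto
      finally show "ndist nrm (x + d) S \<le> C * (norm (x - s) + B)" .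
    qed
  qed
  have gap: "\<exists>d\<in>orc x S. \<beta> * e / 2 < ndist nrm (x + d) S"
    if S: "S \<noteq> {}" and y: "nrm (y - x) < r" and e: "e \<le> ndist nrm y S" "0 < e" for x S y e
  proof -
    have "y - x \<in> closure (nball nrm r 0)"
      using y closure_subset[of "nball nrm r 0"] by (auto simp: nball_def)
    then have "ndist nrm (x + (y - x)) S \<le> (SUP d\<in>closure (nball nrm r 0). ndist nrm (x + d) S)"
      using bdd[OF S subset_refl] by (rule cSUP_upper)
    then have "e \<le> (SUP d\<in>closure (nball nrm r 0). ndist nrm (x + d) S)"
      using e(1) by simp
    then have "\<beta> * e \<le> \<beta> * (SUP d\<in>closure (nball nrm r 0). ndist nrm (x + d) S)"
      using \<beta> by simp
    also have "\<dots> \<le> (SUP d\<in>orc x S. ndist nrm (x + d) S)"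
      by (rule orc(3)[OF S])
    finally have "\<beta> * e \<le> (SUP d\<in>orc x S. ndist nrm (x + d) S)" .
    moreover have "0 < \<beta> * e" using \<beta> e(2) by simp
    ultimately have "\<beta> * e / 2 < (SUP d\<in>orc x S. ndist nrm (x + d) S)"
      by linarith
    then show ?thesis
      unfolding less_cSUP_iff[OF orc(1)[OF S] bdd[OF S orc(2)[OF S]]] .
  qed
  show ?thesis
    by (rule that[OF \<beta> orc(2) gap])
qed

text \<open>
  Boundedness of the iterates keeps all trial points in a bounded set, where no infinite
  sequence can have all its terms at least a fixed positive distance apart. Each trial point joins
  the history, so it is one of the points from which the later ones would have to keep that distance.
\<close>

lemma covering_radius_tendsto_zero:
  fixes nrm :: "'a::euclidean_space \<Rightarrow> real"
  assumes nrm: "is_norm nrm" and orc: "covering_oracle nrm r orc"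
    and run: "algorithm_run f orc x H" and "bounded (range x)" and e: "0 < e"
  shows "\<forall>\<^sub>F k in sequentially. \<forall>y. nrm (y - x k) < r \<longrightarrow> ndist nrm y (H k) < e"
    (is ?covered)
proof (rule ccontr)
  assume contra: "\<not> ?covered"
  obtain \<beta> where \<beta>: "0 < \<beta>"
    and sub: "\<And>x S. S \<noteq> {} \<Longrightarrow> orc x S \<subseteq> closure (nball nrm r 0)"
    and gap: "\<And>x S y e. \<lbrakk>S \<noteq> {}; nrm (y - x) < r; e \<le> ndist nrm y S; 0 < e\<rbrakk> \<Longrightarrow>
       \<exists>d\<in>orc x S. \<beta> * e / 2 < ndist nrm (x + d) S"
    using covering_oracle_gap[OF nrm orc] by metis
  obtain C where C: "0 < C" "\<And>z. nrm z \<le> C * norm z"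
    using is_norm_upper[OF nrm] by blast
  have it: "iteration f orc (x k) (H k) (x (Suc k)) (H (Suc k))" for k
    using run unfolding algorithm_run_def by blast
  \<comment> \<open>The oracle promises nothing for the empty initial history, so \<open>k = 0\<close> is left out.\<close>
  define M where "M = {k. 0 < k \<and> (\<exists>y. nrm (y - x k) < r \<and> e \<le> ndist nrm y (H k))}"
  have "infinite M"
  proof
    assume "finite M"
    then have "\<forall>\<^sub>F k in sequentially. k \<notin> M"
      by (simp add: eventually_cofinite flip: cofinite_eq_sequentially)
    then have ?covered
      using eventually_gt_at_top[of 0]
      by eventually_elim (auto simp: M_def not_le)
    then show False using contra by blast
  qed
  have ne: "H k \<noteq> {}" if "k \<in> M" for k
    using iteration_history_nonempty[OF it[of "k - 1"]] that by (simp add: M_def)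
  have "\<exists>d\<in>orc (x k) (H k). \<beta> * e / 2 < ndist nrm (x k + d) (H k)" if "k \<in> M" for k
    using gap[OF ne[OF that]] that e unfolding M_def by blast
  then obtain d where d: "\<And>k. k \<in> M \<Longrightarrow> d k \<in> orc (x k) (H k)"
    "\<And>k. k \<in> M \<Longrightarrow> \<beta> * e / 2 < ndist nrm (x k + d k) (H k)"
    by metis
  have "bounded (\<Union>u\<in>range x. \<Union>v\<in>closure (nball nrm r 0). {u + v})"
    by (intro bounded_sums assms(4) bounded_closure bounded_nball nrm)
  then have "bounded ((\<lambda>k. x k + d k) ` M)"
  proof (rule bounded_subset, intro image_subsetI)
    fix k assume k: "k \<in> M"
    then have "d k \<in> closure (nball nrm r 0)"
      using d(1) sub[OF ne] by blast
    then show "x k + d k \<in> (\<Union>u\<in>range x. \<Union>v\<in>closure (nball nrm r 0). {u + v})"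
      by auto
  qed
  moreover have "0 < \<beta> * e / 2 / C" using \<beta> e C(1) by simp
  ultimately obtain j k where jk: "j \<in> M" "k \<in> M" "j < k"
    "dist (x j + d j) (x k + d k) < \<beta> * e / 2 / C"
    using bounded_sequence_close_pair[OF \<open>infinite M\<close>] by blast
  have "x j + d j \<in> H (Suc j)"
    using iteration_trial_subset[OF it[of j]] d(1)[OF jk(1)] by blast
  also have "H (Suc j) \<subseteq> H k"
    using run_history_incseq[OF run] jk(3) by (simp add: incseq_def)
  finally have "ndist nrm (x k + d k) (H k) \<le> nrm ((x k + d k) - (x j + d j))"
    by (rule ndist_le[OF nrm])
  also have "\<dots> \<le> C * dist (x j + d j) (x k + d k)"
    using C(2) by (metis dist_norm dist_commute)
  also have "\<dots> < \<beta> * e / 2"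
    using jk(4) C(1) by (simp add: field_simps)
  finally show False
    using d(2)[OF jk(2)] by simp
qed

text \<open>
  The covering radius along the run refers to balls around the iterates. Only the open ball around
  the limit is sure to have each of its points in the balls around nearby iterates.
\<close>

lemma nball_subset_closure_history:
  fixes nrm :: "'a::euclidean_space \<Rightarrow> real"
  assumes nrm: "is_norm nrm" and orc: "covering_oracle nrm r orc"
    and run: "algorithm_run f orc x H" and bx: "bounded (range x)"
    and K: "infinite K" and lim: "(x \<circ> enumerate K) \<longlonglongrightarrow> a"
  shows "nball nrm r a \<subseteq> closure (\<Union>k. H k)"
proof
  fix y assume y: "y \<in> nball nrm r a"
  obtain c where c: "0 < c" "\<And>z. c * norm z \<le> nrm z"
    using is_norm_lower[OF nrm] by blast
  \<comment> \<open>Nearby centres \<open>x k\<close> still have \<open>y\<close> in their ball, by openness of the ball around \<open>y\<close>.\<close>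
  have "a \<in> nball nrm r y"
    using y is_norm_minus_commute[OF nrm] by (simp add: nball_def)
  then have near: "\<forall>\<^sub>F i in sequentially. x (enumerate K i) \<in> nball nrm r y"
    using topological_tendstoD[OF lim open_nball[OF nrm]] by simp
  show "y \<in> closure (\<Union>k. H k)"
    unfolding closure_approachable
  proof (intro allI impI)
    fix e :: real assume e: "0 < e"
    then have "0 < c * e" using c(1) by simp
    note cover = covering_radius_tendsto_zero[OF nrm orc run bx this]
    have "filterlim (enumerate K) sequentially sequentially"
      using strict_mono_enumerate[OF K] filterlim_subseq by blast
    then have "\<forall>\<^sub>F i in sequentially. 0 < enumerate K i \<and>
        (\<forall>y. nrm (y - x (enumerate K i)) < r \<longrightarrow> ndist nrm y (H (enumerate K i)) < c * e)"
      using eventually_conj[OF eventually_gt_at_top[of 0] cover] by (auto simp: filterlim_iff)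
    then have "\<forall>\<^sub>F i in sequentially. 0 < enumerate K i \<and> ndist nrm y (H (enumerate K i)) < c * e"
      using near by eventually_elim (simp add: nball_def is_norm_minus_commute[OF nrm])
    then obtain k where k: "0 < k" "ndist nrm y (H k) < c * e"
      using eventually_happens'[OF sequentially_bot] by blast
    have "iteration f orc (x (k - 1)) (H (k - 1)) (x (Suc (k - 1))) (H (Suc (k - 1)))"
      using run unfolding algorithm_run_def by blast
    then have "H k \<noteq> {}"
      using iteration_history_nonempty k(1) by fastforce
    then obtain h where h: "h \<in> H k" "nrm (y - h) < c * e"
      using ndist_less_witness k(2) by metis
    have "c * norm (y - h) < c * e"
      using c(2)[of "y - h"] h(2) by linarith
    then have "dist h y < e"
      using c(1) by (simp add: dist_norm norm_minus_commute)
    then show "\<exists>h\<in>\<Union>k. H k. dist h y < e"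
      using h(1) by blast
  qed
qed

section \<open>Convergence\<close>

theorem theorem2:
  fixes nrm :: "real ^ 'n \<Rightarrow> real"
    and f :: "real ^ 'n \<Rightarrow> ereal"
    and X :: "(real ^ 'n) set"
    and N :: enat
    and P :: "nat \<Rightarrow> (real ^ 'n) set"
    and r :: real
    and orc :: "real ^ 'n \<Rightarrow> (real ^ 'n) set \<Rightarrow> (real ^ 'n) set"
    and x :: "nat \<Rightarrow> real ^ 'n"
    and H :: "nat \<Rightarrow> (real ^ 'n) set"
  assumes "is_norm nrm"
    and "\<forall>y. f y \<noteq> -\<infinity>"
    and "X = {y. f y \<noteq> \<infinity>}"
    and "\<exists>m::real. \<forall>y. ereal m \<le> f y"
    and "\<forall>c::real. bounded {y. f y \<le> ereal c}"
    and "lower_semicontinuous_on X f"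
    and "1 \<le> N"
    and "disjoint_family_on P {i. 1 \<le> i \<and> enat i \<le> N}"
    and "X = (\<Union>i\<in>{i. 1 \<le> i \<and> enat i \<le> N}. P i)"
    and "\<forall>i. 1 \<le> i \<and> enat i \<le> N \<longrightarrow> ample (P i) \<and> continuous_on (P i) f"
    and "0 < r"
    and "covering_oracle nrm r orc"
    and "algorithm_run f orc x H"
  shows "subseq_limits x \<noteq> {} \<and>
    (\<forall>a\<in>subseq_limits x. \<forall>K. infinite K \<and> (x \<circ> enumerate K) \<longlonglongrightarrow> a \<longrightarrow>
       (a \<in> X \<longrightarrow> a \<in> argmin_on f (nball nrm r a) \<and> (f \<circ> x \<circ> enumerate K) \<longlonglongrightarrow> f a) \<and>
       (a \<notin> X \<longrightarrow> (f \<circ> x \<circ> enumerate K) \<longlonglongrightarrow> (INF y\<in>nball nrm r a. f y)))"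
proof (intro conjI ballI allI impI; (elim conjE)?)
  have X: "X = {y. f y \<noteq> \<infinity>}" and run: "algorithm_run f orc x H" and nrm: "is_norm nrm"
    using assms by blast+
  have dec: "decseq (\<lambda>k. f (x k))"
    by (rule run_values_decseq[OF run])
  define L where "L = (INF k. f (x k))"
  have L: "(\<lambda>k. f (x k)) \<longlonglongrightarrow> L"
    unfolding L_def by (rule LIMSEQ_INF[OF dec])
  have start: "f (x k) \<le> f (x 0)" for k
    using dec by (simp add: decseq_def)
  have "f (x 0) \<noteq> \<infinity>"
    using run unfolding algorithm_run_def by blast
  then have xX: "x k \<in> X" for k
    using start[of k] unfolding X by auto
  obtain c where "f (x 0) = ereal c"
    using \<open>f (x 0) \<noteq> \<infinity>\<close> assms(2) by (cases "f (x 0)") auto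
  then have "range x \<subseteq> {y. f y \<le> ereal c}"
    using start by auto
  then have bx: "bounded (range x)"
    using assms(5) bounded_subset by blast
  then obtain l q where q: "strict_mono (q :: nat \<Rightarrow> nat)" "(x \<circ> q) \<longlonglongrightarrow> l"
    using bounded_imp_convergent_subsequence by blast
  have "infinite (range q) \<and> (x \<circ> enumerate (range q)) \<longlonglongrightarrow> l"
    using q by (simp add: range_inj_infinite strict_mono_imp_inj_on enumerate_range_strict_mono)
  then show "subseq_limits x \<noteq> {}"
    unfolding subseq_limits_def by blast

  fix a K assume K: "infinite K" and lim: "(x \<circ> enumerate K) \<longlonglongrightarrow> a"
  have fL: "(f \<circ> x \<circ> enumerate K) \<longlonglongrightarrow> L"
    using LIMSEQ_subseq_LIMSEQ[OF L strict_mono_enumerate[OF K]] by (simp add: comp_def)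
  have dense: "nball nrm r a \<subseteq> closure (\<Union>k. H k)"
    by (rule nball_subset_closure_history[OF nrm assms(12) run bx K lim])
  have hist: "L \<le> f h" if "h \<in> (\<Union>k. H k)" for h
    using that run_history_value[OF run] unfolding L_def by (auto intro: INF_lower2)
  have lower: "L \<le> f y" if y: "y \<in> nball nrm r a" for y
  proof (cases "y \<in> X")
    case True
    then obtain i where i: "1 \<le> i" "enat i \<le> N" "y \<in> P i"
      using assms(9) by blast
    then have "ample (P i)" "continuous_on (P i) f"
      using assms(10) by blast+
    then show ?thesis
      by (rule ample_continuous_lower_bound[OF _ _ open_nball[OF nrm] dense hist y i(3)])
  next
    case False
    then show ?thesis unfolding X by simp
  qed
  have "nrm 0 = 0"
    using nrm unfolding is_norm_def by blast
  then have centre: "a \<in> nball nrm r a"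
    using assms(11) by (simp add: nball_def)
  {
    assume a: "a \<in> X"
    have "f a \<le> L"
      using lower_semicontinuous_on_sequence[OF assms(6) a xX, of "enumerate K"] lim fL
      by (simp add: comp_def)
    then have "f a = L"
      using lower[OF centre] by (rule antisym)
    then show "a \<in> argmin_on f (nball nrm r a)" "(f \<circ> x \<circ> enumerate K) \<longlonglongrightarrow> f a"
      using fL lower centre unfolding argmin_on_def is_arg_min_def by (auto simp: not_less)
  }
  have "\<forall>\<^sub>F i in sequentially. x (enumerate K i) \<in> nball nrm r a"
    using topological_tendstoD[OF lim open_nball[OF nrm] centre] by simp
  then have "\<forall>\<^sub>F i in sequentially. (INF y\<in>nball nrm r a. f y) \<le> (f \<circ> x \<circ> enumerate K) i"
    by eventually_elim (auto intro: INF_lower)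
  then have "(INF y\<in>nball nrm r a. f y) \<le> L"
    by (intro tendsto_lowerbound[OF fL]) auto
  moreover have "L \<le> (INF y\<in>nball nrm r a. f y)"
    by (intro INF_greatest lower)
  ultimately show "(f \<circ> x \<circ> enumerate K) \<longlonglongrightarrow> (INF y\<in>nball nrm r a. f y)"
    using fL by (metis antisym)
qed

end
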